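(* Fix a tree partition of $\omega$ with associated ideals $\mathcal H_n$ and $\mathcal H_{<\omega}=\bigcup_n\mathcal H_n$. For every $N\ge1$ there are maps $q_k:\omega\to\omega^k$ $(1\le k\le N)$ commuting with the suffix projections, i.e. $q_k=\pi_{k,N}\circ q_N$ for all $k\le N$, such that each $q_k$ witnesses $\mathrm{Fin}^{\otimes k}\le_K\mathcal H_{<\omega}$. Moreover, the maps can be taken so that all preimages of small sets lie in the single level $\mathcal H_{N-1}$: $q_k^{-1}[B]\in\mathcal H_{N-1}$ for every $k\le N$ and every $B\in\mathrm{Fin}^{\otimes k}$.
   Context: A tree partition of $\omega$ is a family $\langle A_s:s\in\omega^{<\omega}\rangle$ of infinite subsets of $\omega$ such that $A_\varnothing=\omega$, for each $s$ the family $\{A_{s^\frown n}:n\in\omega\}$ is a partition of $A_s$, and any two distinct points of $\omega$ lie in different cells $A_s\neq A_t$ with $|s|=|t|=n$ for some $n$. For $X\subseteq\omega$ let $T^\infty_X=\{s\in\omega^{<\omega}:X\cap A_s\text{ is infinite}\}$. For $T\subseteq\omega^{<\omega}$ put $\mathrm{Succ}_T(s)=\{n:s^\frown n\in T\}$ and $D(T)=\{s\in T:\mathrm{Succ}_T(s)\text{ is infinite}\}$; $D^0(T)=T$, $D^{n+1}(T)=D(D^n(T))$. For $n<\omega$, $\mathcal H_n=\{X\subseteq\omega:\varnothing\notin D^n(T^\infty_X)\}$ (an ideal on $\omega$). $\mathrm{Fin}$ is the ideal of finite subsets of $\omega$; $\mathrm{Fin}^{\otimes1}=\mathrm{Fin}$,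 and $\mathrm{Fin}^{\otimes(k+1)}$ is the ideal on $\omega^{k+1}$ of all $C$ such that for all but finitely many $n$ the section $\{t\in\omega^k:(n)^\frown t\in C\}$ belongs to $\mathrm{Fin}^{\otimes k}$. For $k\le N$, $\pi_{k,N}:\omega^N\to\omega^k$ is the projection onto the last $k$ coordinates. A map $q:\omega\to\omega^k$ witnesses $\mathrm{Fin}^{\otimes k}\le_K\mathcal H_{<\omega}$ if $q^{-1}[B]\in\mathcal H_{<\omega}$ for every $B\in\mathrm{Fin}^{\otimes k}$. *)

theory Defs
  imports Main "HOL-Library.Disjoint_Sets"
begin

text \<open>Elements of \<open>\<omega>\<^sup><\<^sup>\<omega>\<close> are lists of naturals, with first coordinate at the head, so that
  \<open>s\<^sup>\<frown>n\<close> is \<open>s @ [n]\<close> and \<open>(n)\<^sup>\<frown>t\<close> is \<open>n # t\<close>.\<close>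

definition tree_partition :: "(nat list \<Rightarrow> nat set) \<Rightarrow> bool" where
  "tree_partition A \<longleftrightarrow>
     (\<forall>s. infinite (A s)) \<and>
     A [] = UNIV \<and>
     (\<forall>s. disjoint_family (\<lambda>n. A (s @ [n])) \<and> (\<Union>n. A (s @ [n])) = A s) \<and>
     (\<forall>x y. x \<noteq> y \<longrightarrow>
        (\<exists>n s t. length s = n \<and> length t = n \<and> x \<in> A s \<and> y \<in> A t \<and> A s \<noteq> A t))"

definition T_inf :: "(nat list \<Rightarrow> nat set) \<Rightarrow> nat set \<Rightarrow> nat list set" where
  "T_inf A X = {s. infinite (X \<inter> A s)}"

definition Succ_set :: "nat list set \<Rightarrow> nat list \<Rightarrow> nat set" where
  "Succ_set T s = {n. s @ [n] \<in> T}"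

definition D :: "nat list set \<Rightarrow> nat list set" where
  "D T = {s \<in> T. infinite (Succ_set T s)}"

definition H :: "(nat list \<Rightarrow> nat set) \<Rightarrow> nat \<Rightarrow> nat set set" where
  "H A n = {X. [] \<notin> (D ^^ n) (T_inf A X)}"

definition H_lt_omega :: "(nat list \<Rightarrow> nat set) \<Rightarrow> nat set set" where
  "H_lt_omega A = (\<Union>n. H A n)"

definition omega_pow :: "nat \<Rightarrow> nat list set" where
  "omega_pow k = {t. length t = k}"

text \<open>\<open>Fin_pow k\<close> is \<open>Fin\<^sup>\<otimes>\<^sup>k\<close> as a family of subsets of \<open>omega_pow k\<close>, where \<open>omega_pow 1\<close> is
  identified with \<open>\<omega>\<close>. The value at \<open>0\<close> is a dummy; only \<open>k \<ge> 1\<close> is meaningful.\<close>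

fun Fin_pow :: "nat \<Rightarrow> nat list set set" where
  "Fin_pow 0 = {}"
| "Fin_pow (Suc 0) = {C. C \<subseteq> omega_pow 1 \<and> finite C}"
| "Fin_pow (Suc (Suc k)) =
     {C. C \<subseteq> omega_pow (Suc (Suc k)) \<and>
         finite {n. {t \<in> omega_pow (Suc k). n # t \<in> C} \<notin> Fin_pow (Suc k)}}"

definition suffix_proj :: "nat \<Rightarrow> nat \<Rightarrow> nat list \<Rightarrow> nat list" where
  "suffix_proj k N t = drop (N - k) t"

definition katetov_witness :: "(nat list \<Rightarrow> nat set) \<Rightarrow> nat \<Rightarrow> (nat \<Rightarrow> nat list) \<Rightarrow> bool" where
  "katetov_witness A k q \<longleftrightarrow>
     range q \<subseteq> omega_pow k \<and> (\<forall>B \<in> Fin_pow k. q -` B \<in> H_lt_omega A)"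

end

theory Submission
  imports Defs
begin

text \<open>
  Every point \<open>x\<close> of \<open>\<omega>\<close> lies in exactly one cell of each level. Let \<open>q\<^sub>N(x)\<close> be the address of the
  level \<open>N - 1\<close> cell of \<open>x\<close> followed by \<open>x\<close> itself, and let \<open>q\<^sub>k\<close> be the last \<open>k\<close> coordinates of
  \<open>q\<^sub>N\<close>, so that the maps commute with the suffix projections by construction.

  Suppose that \<open>X = q\<^sub>k\<^sup>-\<^sup>1[B]\<close> is not in the ideal of level \<open>N - 1\<close>. Then \<open>T\<^sup>\<infinity>\<^sub>X\<close> contains an
  infinitely branching tree of height \<open>N - 1\<close> rooted at the empty sequence. Following it for
  \<open>N - k\<close> steps leads to a node \<open>v\<close> above which infinite branching persists for another \<open>k - 1\<close>
  steps (lemma \<open>iterated_D_reaches_length\<close>), and \<open>X\<close> has infinitely many points in each cell at the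
  top. On the cell \<open>A\<^sub>v\<close> the map \<open>q\<^sub>k\<close> sends a point to the
  remaining \<open>k - 1\<close> entries of its address followed by the point. Its values on \<open>X \<inter> A\<^sub>v\<close>
  therefore contain a set that branches infinitely in each of its \<open>k\<close> coordinates, which no
  member of \<open>Fin\<^sup>\<otimes>\<^sup>k\<close> can cover (lemma \<open>not_Fin_pow_of_iterated_D\<close>). Hence \<open>B\<close> is not in
  \<open>Fin\<^sup>\<otimes>\<^sup>k\<close>.
\<close>

lemma tree_partition_ex1_cell:
  assumes "tree_partition A"
  shows "\<exists>!s. length s = m \<and> x \<in> A s"
proof (induction m)
  case 0
  then show ?case using assms by (auto simp: tree_partition_def)
next
  case (Suc m)
  have split: "(\<Union>n. A (s @ [n])) = A s" and disj: "disjoint_family (\<lambda>n. A (s @ [n]))" for s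
    using assms by (auto simp: tree_partition_def)
  from Suc obtain s where s: "length s = m" "x \<in> A s"
    and s_unique: "\<And>t. length t = m \<Longrightarrow> x \<in> A t \<Longrightarrow> t = s" by blast
  from s split obtain n where n: "x \<in> A (s @ [n])" by blast
  show ?case
  proof (rule ex1I)
    show "length (s @ [n]) = Suc m \<and> x \<in> A (s @ [n])" using s n by simp
  next
    fix t assume t: "length t = Suc m \<and> x \<in> A t"
    then obtain t' i where ti: "t = t' @ [i]" by (metis length_Suc_conv_rev)
    with t split have "length t' = m" "x \<in> A t'" by auto
    then have "t' = s" by (rule s_unique)
    with t ti n disj[of s] have "i = n"
      by (auto simp: disjoint_family_on_def)
    then show "t = s @ [n]" using ti \<open>t' = s\<close> by simp
  qed
qed

definition cell_address :: "(nat list \<Rightarrow> nat set) \<Rightarrow> nat \<Rightarrow> nat \<Rightarrow> nat list" where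
  "cell_address A m x = (THE s. length s = m \<and> x \<in> A s)"

lemma length_cell_address:
  assumes "tree_partition A"
  shows "length (cell_address A m x) = m"
  using theI'[OF tree_partition_ex1_cell[OF assms]] unfolding cell_address_def by blast

lemma cell_address_eq:
  assumes "tree_partition A" "x \<in> A s"
  shows "cell_address A (length s) x = s"
  unfolding cell_address_def
  using assms by (intro the1_equality tree_partition_ex1_cell) auto

lemma mem_D_iff: "s \<in> D T \<longleftrightarrow> s \<in> T \<and> infinite {n. s @ [n] \<in> T}"
  by (simp add: D_def Succ_set_def)

text \<open>Each application of \<open>D\<close> pays for one step upwards in the tree, so \<open>i\<close> of the \<open>i + j\<close>
  applications can be traded for an extension of length \<open>i\<close>.\<close>

lemma iterated_D_reaches_length:
  assumes "u \<in> (D ^^ (i + j)) T"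
  shows "\<exists>v. length v = i \<and> u @ v \<in> (D ^^ j) T"
  using assms
proof (induction i arbitrary: u)
  case 0
  then show ?case by simp
next
  case (Suc i)
  then have "infinite {n. u @ [n] \<in> (D ^^ (i + j)) T}"
    by (simp add: mem_D_iff)
  then obtain n where "u @ [n] \<in> (D ^^ (i + j)) T"
    using not_finite_existsD by blast
  from Suc.IH[OF this] obtain v where "length v = i" "(u @ [n]) @ v \<in> (D ^^ j) T" by blast
  then show ?case by (intro exI[of _ "n # v"]) simp
qed

text \<open>Infinite branching of \<open>T\<^sup>\<infinity>\<^sub>X\<close> above \<open>u\<close> matches positivity for \<open>Fin\<^sup>\<otimes>\<^sup>j\<^sup>+\<^sup>1\<close> one coordinate
  at a time: a successor \<open>u @ [n]\<close> at which \<open>j\<close> further levels of branching survive makes the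
  section of \<open>B\<close> at \<open>n\<close> positive, and there are infinitely many such \<open>n\<close>. After \<open>j\<close> steps only
  the last coordinate is left, which lists the infinitely many points of \<open>X\<close> in a single cell.\<close>

lemma not_Fin_pow_of_iterated_D:
  assumes "u \<in> (D ^^ j) (T_inf A X)"
    and "\<And>t x. length t = j \<Longrightarrow> x \<in> X \<Longrightarrow> x \<in> A (u @ t) \<Longrightarrow> t @ [x] \<in> B"
  shows "B \<notin> Fin_pow (Suc j)"
  using assms
proof (induction j arbitrary: u B)
  case 0
  then have "infinite ((\<lambda>x. [x]) ` (X \<inter> A u))"
    by (simp add: T_inf_def finite_image_iff inj_on_def)
  moreover have "(\<lambda>x. [x]) ` (X \<inter> A u) \<subseteq> B"
    using "0.prems"(2)[of "[]"] by auto
  ultimately have "infinite B" using finite_subset by blast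
  then show ?case by simp
next
  case (Suc j)
  let ?section = "\<lambda>n. {t \<in> omega_pow (Suc j). n # t \<in> B}"
  have "infinite {n. u @ [n] \<in> (D ^^ j) (T_inf A X)}"
    using Suc.prems(1) by (simp add: mem_D_iff)
  moreover have "?section n \<notin> Fin_pow (Suc j)" if "u @ [n] \<in> (D ^^ j) (T_inf A X)" for n
  proof (rule Suc.IH[OF that])
    fix t x assume "length t = j" "x \<in> X" "x \<in> A ((u @ [n]) @ t)"
    with Suc.prems(2)[of "n # t" x] show "t @ [x] \<in> ?section n"
      by (simp add: omega_pow_def)
  qed
  ultimately have "infinite {n. ?section n \<notin> Fin_pow (Suc j)}"
    by (metis (mono_tags, lifting) Collect_mono finite_subset)
  then show ?case by simp
qed

theorem proposition4p5:
  fixes A :: "nat list \<Rightarrow> nat set" and N :: nat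
  assumes "tree_partition A" and "N \<ge> 1"
  shows "\<exists>q :: nat \<Rightarrow> nat \<Rightarrow> nat list.
           (\<forall>k\<in>{1..N}. range (q k) \<subseteq> omega_pow k) \<and>
           (\<forall>k\<in>{1..N}. q k = suffix_proj k N \<circ> q N) \<and>
           (\<forall>k\<in>{1..N}. katetov_witness A k (q k)) \<and>
           (\<forall>k\<in>{1..N}. \<forall>B \<in> Fin_pow k. q k -` B \<in> H A (N - 1))"
proof -
  define q where "q k x = drop (N - k) (cell_address A (N - 1) x @ [x])" for k x
  have range: "range (q k) \<subseteq> omega_pow k" if "k \<in> {1..N}" for k
    using that length_cell_address[OF assms(1)] by (auto simp: q_def omega_pow_def)
  have proj: "q k = suffix_proj k N \<circ> q N" for k
    by (simp add: fun_eq_iff q_def suffix_proj_def)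
  have small: "q k -` B \<in> H A (N - 1)" if k: "k \<in> {1..N}" and B: "B \<in> Fin_pow k" for k B
  proof (rule ccontr)
    let ?T = "T_inf A (q k -` B)"
    assume "q k -` B \<notin> H A (N - 1)"
    then have "[] \<in> (D ^^ (N - 1)) ?T" by (simp add: H_def)
    moreover have "N - 1 = (N - k) + (k - 1)" using k by simp
    ultimately obtain v where v: "length v = N - k" "v \<in> (D ^^ (k - 1)) ?T"
      using iterated_D_reaches_length[of "[]" "N - k" "k - 1"] by auto
    have "B \<notin> Fin_pow (Suc (k - 1))"
    proof (rule not_Fin_pow_of_iterated_D[OF v(2)])
      fix t x assume t: "length t = k - 1" and x: "x \<in> q k -` B" "x \<in> A (v @ t)"
      have "cell_address A (N - 1) x = v @ t"
        using cell_address_eq[OF assms(1) x(2)] t v(1) k by simp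
      then show "t @ [x] \<in> B" using x(1) v(1) by (simp add: q_def)
    qed
    with B k show False by simp
  qed
  then have "katetov_witness A k (q k)" if "k \<in> {1..N}" for k
    using range that by (auto simp: katetov_witness_def H_lt_omega_def)
  with range proj small show ?thesis by blast
qed

end
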